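(* Let $G$ be a finite connected simple undirected graph with $N$ vertices and normalized graph Laplacian $L$, and let $T>0$, $a\ge 0$, $q\ge 0$, $\varepsilon\ge0$, $c>0$ with $q^2\le\varepsilon$. If $$\max\left\{100\,T[c+T(\varepsilon-q^2)]\,\|L\|^2,\ \frac{2}{\log 2}(a+q)T\|L\|\right\}\le 1,$$ then the coupled Riccati system $$\dot F^i_t+\sum_{j=1}^N[-(a+q)L-F^j_t]e_je_j^{\top}F^i_t+\sum_{j=1}^N F^i_te_je_j^{\top}[-(a+q)L-F^j_t]+(\varepsilon-q^2)Le_ie_i^{\top}L+F^i_te_ie_i^{\top}F^i_t=0,\quad F^i_T=cLe_ie_i^{\top}L,\qquad i\in[N],$$ for $F^1,\dots,F^N:[0,T]\to\mathbb{S}^{N\times N}$, admits a unique solution on $[0,T]$.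
   Context: $[N]=\{1,\dots,N\}$; $\mathbb{S}^{N\times N}$ is the set of real symmetric $N\times N$ matrices; $\|\cdot\|$ is the matrix 2-norm; $e_1,\dots,e_N$ is the standard basis of $\mathbb{R}^N$; $\log$ is the natural logarithm. For a graph with vertices $v_1,\dots,v_N$ and degrees $d_{v_i}$, the normalized graph Laplacian $L\in\mathbb{S}^{N\times N}$ is $L_{ii}=1$, $L_{ij}=-1/\sqrt{d_{v_i}d_{v_j}}$ if $i\neq j$ and $v_i$, $v_j$ are adjacent, $L_{ij}=0$ otherwise. *)

theory Defs
  imports "HOL-Analysis.Analysis" "Graph_Theory.Digraph_Component"
begin

text \<open>A finite simple undirected graph is a \<open>graph\<close> in the sense of \<open>Graph_Theory\<close>: a finite
  digraph, symmetric, without loops and without parallel arcs.  Hence each undirected edge is a pair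
  of opposite arcs, and the degree of a vertex is its out-degree.  The vertices
  \<open>v\<^sub>1, \<dots>, v\<^sub>N\<close> are enumerated by a map \<open>v\<close> defined on a finite type with \<open>N\<close> elements.\<close>

definition normalized_laplacian ::
    "('a, 'b) pre_digraph \<Rightarrow> ('n::finite \<Rightarrow> 'a) \<Rightarrow> real ^ 'n ^ 'n" where
  "normalized_laplacian G v =
     (\<chi> i j. if i = j then 1
            else if v i \<rightarrow>\<^bsub>G\<^esub> v j
              then - 1 / sqrt (real (out_degree G (v i)) * real (out_degree G (v j)))
            else 0)"

text \<open>The matrix 2-norm; \<open>norm\<close> on \<open>real ^ 'n ^ 'n\<close> is the Frobenius norm instead.\<close>

definition matrix_norm2 :: "real ^ 'n ^ 'n::finite \<Rightarrow> real" where
  "matrix_norm2 A = onorm (\<lambda>x. A *v x)"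

text \<open>The matrix \<open>e\<^sub>j e\<^sub>j\<^sup>T\<close>.\<close>

definition unit_outer :: "'n::finite \<Rightarrow> real ^ 'n ^ 'n" where
  "unit_outer j = (columnvector (axis j 1) :: real ^ 1 ^ 'n) ** (rowvector (axis j 1) :: real ^ 'n ^ 1)"

text \<open>At the endpoints of \<open>[0, T]\<close> the derivative is one-sided.  Values of \<open>F\<close> outside \<open>[0, T]\<close>
  are irrelevant.\<close>

definition riccati_solution ::
    "real ^ 'n ^ 'n::finite \<Rightarrow> real \<Rightarrow> real \<Rightarrow> real \<Rightarrow> real \<Rightarrow> real \<Rightarrow>
     ('n \<Rightarrow> real \<Rightarrow> real ^ 'n ^ 'n) \<Rightarrow> bool" where
  "riccati_solution L a q \<epsilon> c T F \<longleftrightarrow>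
     (\<forall>i. \<forall>t\<in>{0..T}. transpose (F i t) = F i t) \<and>
     (\<forall>i. \<forall>t\<in>{0..T}. \<exists>D. (F i has_vector_derivative D) (at t within {0..T}) \<and>
        D + (\<Sum>j\<in>UNIV. (- ((a + q) *\<^sub>R L) - F j t) ** unit_outer j ** F i t)
          + (\<Sum>j\<in>UNIV. F i t ** unit_outer j ** (- ((a + q) *\<^sub>R L) - F j t))
          + (\<epsilon> - q\<^sup>2) *\<^sub>R (L ** unit_outer i ** L)
          + F i t ** unit_outer i ** F i t = 0) \<and>
     (\<forall>i. F i T = c *\<^sub>R (L ** unit_outer i ** L))"

end

theory Submission
  imports Defs
begin

text \<open>
  The Laplacian \<open>L\<close> of an undirected graph is symmetric.  With \<open>G\<^sup>i\<^sub>s = F\<^sup>i\<^sub>T\<^sub>-\<^sub>s\<close> the system becomes an autonomous initial value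
  problem \<open>G' = f(G)\<close> whose right-hand side \<open>f\<close> (\<open>riccati_field\<close>) is polynomial, hence Lipschitz on
  bounded sets.  Two solutions on \<open>[0, T]\<close> are continuous and so stay in one bounded set, and a
  Gronwall argument identifies them.

  For existence the point is to find a norm in which all terms of \<open>f\<close> are bounded independently of \<open>N\<close>.
  The coupling enters through the matrix \<open>P = \<Sum>\<^sub>j F\<^sup>j e\<^sub>j e\<^sub>j\<^sup>T\<close>, whose \<open>j\<close>-th column is that of \<open>F\<^sup>j\<close>; a bound
  on every single \<open>\<parallel>F\<^sup>j\<parallel>\<close> controls \<open>\<parallel>P\<parallel>\<close> only up to a factor \<open>\<surd>N\<close>.  Instead, stack the matrices and take
  the operator norm \<open>\<nu>(F)\<close> of \<open>x \<mapsto> (F\<^sup>1 x, \<dots>, F\<^sup>N x)\<close> with the Euclidean norm on the target.  Since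
  \<open>P\<^sup>T x = ((F\<^sup>j x)\<^sub>j)\<^sub>j\<close> for symmetric \<open>F\<^sup>j\<close>, every component of \<open>P\<^sup>T x\<close> is a component of the corresponding block
  of the stacked vector, so \<open>\<parallel>P\<parallel> \<le> \<nu>(F)\<close>.  Likewise the families \<open>(F\<^sup>i e\<^sub>i e\<^sub>i\<^sup>T F\<^sup>i)\<^sub>i\<close> and \<open>(L e\<^sub>i e\<^sub>i\<^sup>T L)\<^sub>i\<close> have
  stacked norm at most \<open>\<nu>(F)\<^sup>2\<close> and \<open>\<parallel>L\<parallel>\<^sup>2\<close>.  Writing \<open>b = a + q\<close>, \<open>\<delta> = \<epsilon> - q\<^sup>2\<close>, \<open>l = \<parallel>L\<parallel>\<close>, this yields
  (\<open>stack_bound_riccati_field\<close>)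

    \<open>\<nu>(f(G)) \<le> 2 b l \<nu>(G) + 3 \<nu>(G)\<^sup>2 + \<delta> l\<^sup>2\<close>,   \<open>\<nu>(G\<^sub>0) \<le> c l\<^sup>2\<close>.

  The scalar function \<open>R(s) = \<kappa> exp (s / T)\<close> with \<open>\<kappa> = (c + T \<delta>) l\<^sup>2\<close> is a majorant: the two smallness
  hypotheses say \<open>100 T \<kappa> \<le> 1\<close> and \<open>2 b T l \<le> ln 2\<close>, and therefore \<open>T (2 b l + 3 R) \<le> ln 2 + 0.09 \<le> 1\<close>, that is,
  \<open>2 b l R + 3 R\<^sup>2 \<le> R'\<close> (\<open>majorant_inequality\<close>).  Hence the integral operator \<open>g \<mapsto> G\<^sub>0 + \<integral> f(g)\<close> preserves the
  symmetric families with \<open>\<nu>(g\<^sub>s) \<le> R(s)\<close>, and Picard iteration inside this moving closed set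
  (\<open>picard_in_moving_closed_set\<close>) converges on all of \<open>[0, T]\<close>.
\<close>

section \<open>An initial value problem in a moving closed set\<close>

text \<open>Letting the constraint set \<open>K s\<close> depend on time is what allows a growing a priori bound
  to be carried through the iteration, so that the solution is obtained on the whole interval in
  one step instead of by continuation.  The iterates contract in the norm
  \<open>sup\<^sub>s exp (- 2 \<Lambda> s) \<parallel>g s\<parallel>\<close>, with factor \<open>1/2\<close> irrespective of \<open>T\<close>.\<close>

lemma picard_in_moving_closed_set:
  fixes f :: "'e::banach \<Rightarrow> 'e" and K :: "real \<Rightarrow> 'e set"
  assumes lip: "\<Lambda>-lipschitz_on (\<Union>s\<in>{0..T}. K s) f"
    and closed: "\<And>s. s \<in> {0..T} \<Longrightarrow> closed (K s)"
    and start: "\<And>s. s \<in> {0..T} \<Longrightarrow> x0 \<in> K s"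
    and inv: "\<And>g s. continuous_on {0..T} g \<Longrightarrow> (\<And>r. r \<in> {0..T} \<Longrightarrow> g r \<in> K r) \<Longrightarrow> s \<in> {0..T} \<Longrightarrow>
                x0 + integral {0..s} (\<lambda>r. f (g r)) \<in> K s"
  obtains g where "g 0 = x0" "\<And>s. s \<in> {0..T} \<Longrightarrow> g s \<in> K s"
    "\<And>s. s \<in> {0..T} \<Longrightarrow> (g has_vector_derivative f (g s)) (at s within {0..T})"
proof (cases "0 \<le> T")
  case False
  then show ?thesis by (intro that[of "\<lambda>_. x0"]) auto
next
  case True
  define P where "P g s = x0 + integral {0..s} (\<lambda>r. f (g r))" for g :: "real \<Rightarrow> 'e" and s
  define good where "good g \<longleftrightarrow> continuous_on {0..T} g \<and> (\<forall>r\<in>{0..T}. g r \<in> K r)" for g :: "real \<Rightarrow> 'e"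
  have \<Lambda>: "\<Lambda> \<ge> 0" using lip by (rule lipschitz_on_nonneg)
  have cont_f: "continuous_on {0..T} (\<lambda>r. f (g r))" if "good g" for g
    using that unfolding good_def
    by (intro continuous_on_compose2[OF lipschitz_on_continuous_on[OF lip]]) auto
  have int_f: "(\<lambda>r. f (g r)) integrable_on {0..s}" if "good g" "s \<in> {0..T}" for g s
    using that by (intro integrable_continuous_real continuous_on_subset[OF cont_f[of g]]) auto
  have P_deriv: "(P g has_vector_derivative f (g s)) (at s within {0..T})"
    if "good g" "s \<in> {0..T}" for g s
    unfolding P_def
    using integral_has_vector_derivative[OF cont_f[OF that(1)] that(2)]
    by (auto intro!: derivative_eq_intros)
  have P_good: "good (P g)" if "good g" for g
    unfolding good_def
  proof
    show "continuous_on {0..T} (P g)"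
      using P_deriv[OF that] by (metis continuous_on_eq_continuous_within has_vector_derivative_continuous)
    show "\<forall>r\<in>{0..T}. P g r \<in> K r"
      using that inv unfolding good_def P_def by blast
  qed
  have contract: "norm (P g s - P h s) \<le> A / 2 * exp (2 * \<Lambda> * s)"
    if g: "good g" and h: "good h" and s: "s \<in> {0..T}"
      and gh: "\<And>r. r \<in> {0..T} \<Longrightarrow> norm (g r - h r) \<le> A * exp (2 * \<Lambda> * r)"
    for g h A s
  proof -
    have A: "A \<ge> 0" using gh[of 0] True by simp (smt (verit) norm_ge_zero)
    \<comment> \<open>The bound is stated through an antiderivative rather than by dividing by \<open>\<Lambda>\<close>, which may be zero.\<close>
    have *: "((\<lambda>r. \<Lambda> * (A * exp (2 * \<Lambda> * r))) has_integral
            A / 2 * exp (2 * \<Lambda> * s) - A / 2 * exp (2 * \<Lambda> * 0)) {0..s}"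
      using s by (intro fundamental_theorem_of_calculus)
        (auto intro!: derivative_eq_intros simp flip: has_real_derivative_iff_has_vector_derivative)
    have "norm (P g s - P h s) = norm (integral {0..s} (\<lambda>r. f (g r) - f (h r)))"
      using int_f[OF g s] int_f[OF h s] by (simp add: P_def integral_diff)
    also have "\<dots> \<le> integral {0..s} (\<lambda>r. \<Lambda> * (A * exp (2 * \<Lambda> * r)))"
    proof (rule integral_norm_bound_integral)
      show "(\<lambda>r. f (g r) - f (h r)) integrable_on {0..s}"
        using int_f[OF g s] int_f[OF h s] by (rule integrable_diff)
      show "(\<lambda>r. \<Lambda> * (A * exp (2 * \<Lambda> * r))) integrable_on {0..s}"
        using * by blast
      fix r assume r: "r \<in> {0..s}"
      then have rT: "r \<in> {0..T}" using s by auto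
      have "norm (f (g r) - f (h r)) \<le> \<Lambda> * norm (g r - h r)"
        using g h rT unfolding good_def by (intro lipschitz_on_normD[OF lip]) blast+
      also have "\<dots> \<le> \<Lambda> * (A * exp (2 * \<Lambda> * r))"
        using gh[OF rT] \<Lambda> by (rule mult_left_mono)
      finally show "norm (f (g r) - f (h r)) \<le> \<Lambda> * (A * exp (2 * \<Lambda> * r))" .
    qed
    also have "\<dots> = A / 2 * exp (2 * \<Lambda> * s) - A / 2 * exp (2 * \<Lambda> * 0)"
      using * by (rule integral_unique)
    also have "\<dots> \<le> A / 2 * exp (2 * \<Lambda> * s)" using A by simp
    finally show ?thesis .
  qed
  define G where "G n = (P ^^ n) (\<lambda>_. x0)" for n
  have G_Suc: "G (Suc n) = P (G n)" for n by (simp add: G_def)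
  have G_good: "good (G n)" for n
  proof (induction n)
    case 0
    show ?case using start by (simp add: G_def good_def)
  qed (simp add: G_Suc P_good)
  obtain C where C: "norm (G 1 s - G 0 s) \<le> C" if "s \<in> {0..T}" for s
  proof -
    have "continuous_on {0..T} (\<lambda>s. norm (G 1 s - G 0 s))"
      using G_good unfolding good_def by (intro continuous_intros) auto
    then have "bounded ((\<lambda>s. norm (G 1 s - G 0 s)) ` {0..T})"
      by (intro compact_imp_bounded compact_continuous_image) auto
    then obtain B where "\<forall>s\<in>{0..T}. norm (norm (G 1 s - G 0 s)) \<le> B"
      unfolding bounded_iff by blast
    then show ?thesis using that[of B] by simp
  qed
  have C0: "C \<ge> 0" using C[of 0] True by simp (smt (verit) norm_ge_zero)
  have step: "norm (G (Suc n) s - G n s) \<le> C * (1/2)^n * exp (2 * \<Lambda> * s)" if "s \<in> {0..T}" for n s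
    using that
  proof (induction n arbitrary: s)
    case 0
    have "C * 1 \<le> C * exp (2 * \<Lambda> * s)"
      using 0 \<Lambda> C0 by (intro mult_left_mono) auto
    then show ?case using C[OF 0] by simp
  next
    case (Suc n)
    then show ?case
      using contract[OF G_good G_good, of s "Suc n" n "C * (1/2)^n"] by (simp add: G_Suc)
  qed
  have step': "norm (G (Suc n) s - G n s) \<le> C * exp (2 * \<Lambda> * T) * (1/2)^n" if "s \<in> {0..T}" for n s
  proof -
    have "C * (1/2)^n * exp (2 * \<Lambda> * s) \<le> C * (1/2)^n * exp (2 * \<Lambda> * T)"
      using that \<Lambda> C0 by (intro mult_left_mono) (auto intro: mult_left_mono)
    then show ?thesis using step[OF that, of n] by (simp add: mult_ac)
  qed
  define g where "g s = x0 + (\<Sum>i. G (Suc i) s - G i s)" for s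
  have "uniform_limit {0..T} (\<lambda>n s. \<Sum>i<n. G (Suc i) s - G i s) (\<lambda>s. \<Sum>i. G (Suc i) s - G i s) sequentially"
    using step' by (rule Weierstrass_m_test) (auto intro!: summable_mult)
  then have "uniform_limit {0..T} (\<lambda>n s. x0 + (\<Sum>i<n. G (Suc i) s - G i s)) g sequentially"
    unfolding g_def by (intro uniform_limit_intros)
  moreover have "x0 + (\<Sum>i<n. G (Suc i) s - G i s) = G n s" for n s
    by (subst sum_lessThan_telescope) (simp add: G_def)
  ultimately have lim: "uniform_limit {0..T} G g sequentially" by simp
  have lim': "(\<lambda>n. G n s) \<longlonglongrightarrow> g s" if "s \<in> {0..T}" for s
    using lim that by (rule tendsto_uniform_limitI)
  have g_good: "good g"
    unfolding good_def
  proof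
    show "continuous_on {0..T} g"
      using G_good by (intro uniform_limit_theorem[OF _ lim]) (auto simp: good_def)
    show "\<forall>r\<in>{0..T}. g r \<in> K r"
      using G_good by (intro ballI closed_sequentially[OF closed _ lim']) (auto simp: good_def)
  qed
  have fixed: "g s = P g s" if s: "s \<in> {0..T}" for s
  proof -
    have "(\<lambda>n. P (G n) s) \<longlonglongrightarrow> P g s"
    proof (rule tendstoI)
      fix e :: real assume e: "e > 0"
      define d where "d = e / exp (2 * \<Lambda> * s)"
      have d: "d > 0" using e by (simp add: d_def)
      show "\<forall>\<^sub>F n in sequentially. dist (P (G n) s) (P g s) < e"
        using uniform_limitD[OF lim d]
      proof eventually_elim
        case (elim n)
        have "norm (G n r - g r) \<le> d * exp (2 * \<Lambda> * r)" if "r \<in> {0..T}" for r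
        proof -
          have "d * 1 \<le> d * exp (2 * \<Lambda> * r)" using d \<Lambda> that by (intro mult_left_mono) auto
          then show ?thesis using bspec[OF elim that] by (simp add: dist_norm)
        qed
        then have "norm (P (G n) s - P g s) \<le> d / 2 * exp (2 * \<Lambda> * s)"
          by (rule contract[OF G_good g_good s])
        also have "\<dots> < e" using e by (simp add: d_def)
        finally show ?case by (simp add: dist_norm)
      qed
    qed
    moreover have "(\<lambda>n. P (G n) s) \<longlonglongrightarrow> g s"
      using LIMSEQ_Suc[OF lim'[OF s]] by (simp add: G_Suc)
    ultimately show ?thesis by (metis LIMSEQ_unique)
  qed
  show ?thesis
  proof (rule that)
    show "g 0 = x0" using fixed[of 0] True by (simp add: P_def)
    show "g s \<in> K s" if "s \<in> {0..T}" for s using g_good that by (auto simp: good_def)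
    show "(g has_vector_derivative f (g s)) (at s within {0..T})" if "s \<in> {0..T}" for s
      using has_vector_derivative_transform[OF that fixed P_deriv[OF g_good that]] by simp
  qed
qed

text \<open>The squared distance of two solutions satisfies \<open>w' \<le> 2 \<Lambda> w\<close>, so \<open>exp (- 2 \<Lambda> s) w s\<close>
  decreases from its initial value \<open>0\<close>.\<close>

lemma ode_solution_unique:
  fixes f :: "'e::real_inner \<Rightarrow> 'e"
  assumes lip: "\<Lambda>-lipschitz_on S f"
    and g: "\<And>s. s \<in> {0..T} \<Longrightarrow> (g has_vector_derivative f (g s)) (at s within {0..T})"
    and h: "\<And>s. s \<in> {0..T} \<Longrightarrow> (h has_vector_derivative f (h s)) (at s within {0..T})"
    and gS: "\<And>s. s \<in> {0..T} \<Longrightarrow> g s \<in> S" and hS: "\<And>s. s \<in> {0..T} \<Longrightarrow> h s \<in> S"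
    and init: "g 0 = h 0" and t: "t \<in> {0..T}"
  shows "g t = h t"
proof -
  define u where "u s = g s - h s" for s
  define w where "w s = exp (- (2 * \<Lambda> * s)) * (u s \<bullet> u s)" for s
  have u: "(u has_vector_derivative f (g s) - f (h s)) (at s within {0..T})" if "s \<in> {0..T}" for s
    unfolding u_def using g[OF that] h[OF that] by (rule has_vector_derivative_diff)
  have cont_u: "continuous_on {0..T} u"
    using u by (metis continuous_on_eq_continuous_within has_vector_derivative_continuous)
  have "w t \<le> w 0"
  proof (rule DERIV_nonpos_imp_decreasing_open[of 0 t w])
    show "0 \<le> t" using t by simp
    show "continuous_on {0..t} w"
      unfolding w_def using t by (intro continuous_intros continuous_on_subset[OF cont_u]) auto
    fix s assume s: "0 < s" "s < t"
    then have sT: "s \<in> {0..T}" and int: "s \<in> interior {0..T}" using t by auto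
    have du: "(u has_vector_derivative f (g s) - f (h s)) (at s)"
      using u[OF sT] at_within_interior[OF int] by simp
    have "((\<lambda>s. u s \<bullet> u s) has_real_derivative 2 * (u s \<bullet> (f (g s) - f (h s)))) (at s)"
      using bounded_bilinear.has_vector_derivative[OF bounded_bilinear_inner du du]
      by (simp add: has_real_derivative_iff_has_vector_derivative inner_commute)
    then have dw: "(w has_real_derivative
        exp (- (2 * \<Lambda> * s)) * (2 * (u s \<bullet> (f (g s) - f (h s))) - 2 * \<Lambda> * (u s \<bullet> u s))) (at s)"
        (is "(_ has_real_derivative ?y) _")
      unfolding w_def by (auto intro!: derivative_eq_intros simp: algebra_simps)
    have "u s \<bullet> (f (g s) - f (h s)) \<le> \<Lambda> * (u s \<bullet> u s)"
    proof -
      have "u s \<bullet> (f (g s) - f (h s)) \<le> norm (u s) * norm (f (g s) - f (h s))"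
        by (rule norm_cauchy_schwarz)
      also have "\<dots> \<le> norm (u s) * (\<Lambda> * norm (u s))"
        using lipschitz_on_normD[OF lip gS[OF sT] hS[OF sT]] by (intro mult_left_mono) (auto simp: u_def)
      also have "\<dots> = \<Lambda> * (u s \<bullet> u s)" by (simp add: power2_norm_eq_inner[symmetric] power2_eq_square)
      finally show ?thesis .
    qed
    then show "\<exists>y. (w has_real_derivative y) (at s) \<and> y \<le> 0"
      using dw by (auto intro!: exI[of _ ?y] mult_nonneg_nonpos)
  qed
  also have "w 0 = 0" using init by (simp add: w_def u_def)
  finally have "u t \<bullet> u t \<le> 0" by (simp add: w_def mult_le_0_iff)
  then have "u t = 0" by (metis inner_eq_zero_iff inner_ge_zero order_antisym)
  then show ?thesis by (simp add: u_def)
qed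

section \<open>The Riccati vector field\<close>

lemma unit_outer_nth: "unit_outer j $ k $ l = (if k = j \<and> l = j then 1 else 0)"
  by (auto simp: unit_outer_def columnvector_def rowvector_def matrix_matrix_mult_def axis_def)

lemma unit_outer_mult_vec: "unit_outer j *v x = x $ j *\<^sub>R axis j 1"
  by (simp add: vec_eq_iff matrix_vector_mult_def unit_outer_nth axis_def if_distrib if_distribR
      cong: if_cong)

lemma transpose_unit_outer: "transpose (unit_outer j) = unit_outer j"
  by (auto simp: vec_eq_iff transpose_def unit_outer_nth)

lemma transpose_add: "transpose (A + B) = transpose A + transpose (B :: real ^ 'n ^ 'm)"
  by (simp add: transpose_def vec_eq_iff)

lemma transpose_diff: "transpose (A - B) = transpose A - transpose (B :: real ^ 'n ^ 'm)"
  by (simp add: transpose_def vec_eq_iff)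

lemma transpose_minus: "transpose (- A) = - transpose (A :: real ^ 'n ^ 'm)"
  by (simp add: transpose_def vec_eq_iff)

lemma transpose_sum: "transpose (\<Sum>j\<in>J. A j) = (\<Sum>j\<in>J. transpose (A j :: real ^ 'n ^ 'm))"
  by (simp add: transpose_def vec_eq_iff)

lemma bounded_linear_transpose: "bounded_linear (transpose :: real ^ 'n ^ 'm \<Rightarrow> real ^ 'm ^ 'n)"
  by (intro linear_conv_bounded_linear[THEN iffD1] linearI transpose_add transpose_scalar)

text \<open>The family \<open>(F\<^sup>i)\<^sub>i\<close> is one vector of matrices, an element of a Euclidean space, so that the
  results of the previous section apply.\<close>

definition riccati_field ::
    "real ^ 'n ^ 'n::finite \<Rightarrow> real \<Rightarrow> real \<Rightarrow> real ^ 'n ^ 'n ^ 'n \<Rightarrow> real ^ 'n ^ 'n ^ 'n" where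
  "riccati_field L b \<delta> X = (\<chi> i.
     (\<Sum>j\<in>UNIV. (- (b *\<^sub>R L) - X $ j) ** unit_outer j ** X $ i)
     + (\<Sum>j\<in>UNIV. X $ i ** unit_outer j ** (- (b *\<^sub>R L) - X $ j))
     + \<delta> *\<^sub>R (L ** unit_outer i ** L) + X $ i ** unit_outer i ** X $ i)"

definition symmetric_family :: "real ^ 'n ^ 'n ^ 'm \<Rightarrow> bool" where
  "symmetric_family X \<longleftrightarrow> (\<forall>i. transpose (X $ i) = X $ i)"

text \<open>Closedness lets the limit of the Picard iterates inherit the constraint.\<close>

lemma closed_symmetric_family: "closed {X :: real ^ 'n ^ 'n ^ 'm. symmetric_family X}"
proof -
  have "continuous_on UNIV (\<lambda>X :: real ^ 'n ^ 'n ^ 'm. transpose (X $ i))" for i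
    by (intro linear_continuous_on bounded_linear_compose[OF bounded_linear_transpose] bounded_linear_vec_nth)
  then show ?thesis
    unfolding symmetric_family_def
    by (intro closed_Collect_all closed_Collect_eq continuous_intros)
qed

lemma symmetric_family_riccati_field:
  assumes L: "transpose L = L" and X: "symmetric_family X"
  shows "symmetric_family (riccati_field L b \<delta> X)"
proof -
  have X': "transpose (X $ i) = X $ i" for i using X by (simp add: symmetric_family_def)
  show ?thesis
    unfolding symmetric_family_def riccati_field_def
    by (simp add: transpose_add transpose_sum transpose_diff transpose_minus transpose_scalar
        matrix_transpose_mul transpose_unit_outer L X' matrix_mul_assoc)
qed

definition stack_apply :: "real ^ 'n ^ 'm ^ 'k \<Rightarrow> real ^ 'n \<Rightarrow> real ^ 'm ^ 'k" where
  "stack_apply X x = (\<chi> i. X $ i *v x)"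

lemma linear_stack_apply: "linear (\<lambda>X. stack_apply X x)"
  by (rule linearI) (simp_all add: stack_apply_def vec_eq_iff algebra_simps matrix_vector_mult_def
      sum.distrib sum_distrib_left)

text \<open>\<open>stack_bound X r\<close> says that the stacked operator norm \<open>\<nu>(X)\<close> is at most \<open>r\<close>.  As a family of
  inequalities, one for each \<open>x\<close>, it is visibly a closed condition and passes through integrals.\<close>

definition stack_bound :: "real ^ 'n ^ 'm ^ 'k \<Rightarrow> real \<Rightarrow> bool" where
  "stack_bound X r \<longleftrightarrow> (\<forall>x. norm (stack_apply X x) \<le> r * norm x)"

lemma closed_stack_bound: "closed {X :: real ^ 'n ^ 'm ^ 'k. stack_bound X r}"
proof -
  have "continuous_on UNIV (\<lambda>X :: real ^ 'n ^ 'm ^ 'k. stack_apply X x)" for x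
    by (intro linear_continuous_on linear_conv_bounded_linear[THEN iffD1] linear_stack_apply)
  then show ?thesis
    unfolding stack_bound_def
    by (intro closed_Collect_all closed_Collect_le continuous_intros)
qed

lemma norm_le_by_components:
  fixes A :: "'a::real_normed_vector ^ 'n" and B :: "'b::real_normed_vector ^ 'n"
  assumes "k \<ge> 0" and "\<And>i. norm (A $ i) \<le> k * norm (B $ i)"
  shows "norm A \<le> k * norm B"
  unfolding norm_vec_def L2_set_right_distrib[OF assms(1)]
  using assms(2) by (intro L2_set_mono) auto

lemma norm_vec_le_sum: "norm (A :: 'a::real_normed_vector ^ 'n) \<le> (\<Sum>i\<in>UNIV. norm (A $ i))"
  unfolding norm_vec_def by (rule L2_set_le_sum) simp

text \<open>The dimension-dependent comparison of \<open>\<nu>\<close> with the norm of the ambient space serves only to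
  see that the constraint sets are bounded; its constant never reaches the smallness condition.\<close>

lemma stack_bound_imp_norm_le:
  fixes X :: "real ^ 'n ^ 'm ^ 'k"
  assumes "stack_bound X r"
  shows "norm X \<le> real CARD('k) * real CARD('m) * real CARD('n) * r"
proof -
  have entry: "norm (X $ i $ k $ l) \<le> r" for i k l
  proof -
    have "norm (X $ i $ k $ l) = norm (stack_apply X (axis l 1) $ i $ k)"
      by (simp add: stack_apply_def matrix_vector_mult_basis column_def)
    also have "\<dots> \<le> norm (stack_apply X (axis l 1))"
      using Finite_Cartesian_Product.norm_nth_le[of "stack_apply X (axis l 1)" i] Finite_Cartesian_Product.norm_nth_le[of "stack_apply X (axis l 1) $ i" k]
      by linarith
    also have "\<dots> \<le> r * norm (axis l (1::real) :: real ^ 'n)"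
      using assms unfolding stack_bound_def by blast
    finally show ?thesis by simp
  qed
  have "norm X \<le> (\<Sum>i\<in>UNIV. \<Sum>k\<in>UNIV. \<Sum>l\<in>UNIV. norm (X $ i $ k $ l))"
    by (rule order_trans[OF norm_vec_le_sum], rule sum_mono, rule order_trans[OF norm_vec_le_sum],
        rule sum_mono, rule norm_vec_le_sum)
  also have "\<dots> \<le> (\<Sum>i\<in>(UNIV :: 'k set). \<Sum>k\<in>(UNIV :: 'm set). \<Sum>l\<in>(UNIV :: 'n set). r)"
    by (intro sum_mono entry)
  finally show ?thesis by (simp add: algebra_simps)
qed

lemma sum_axis: "(\<Sum>j\<in>UNIV. x $ j *\<^sub>R axis j 1) = (x :: real ^ 'n)"
  by (simp add: vec_eq_iff axis_def if_distrib cong: if_cong)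

lemma matrix_vector_mult_sum: "(A :: real ^ 'n ^ 'm) *v (\<Sum>j\<in>J. x j) = (\<Sum>j\<in>J. A *v x j)"
  by (rule linear_sum) (rule matrix_vector_mul_linear)

lemma sum_matrix_vector_mult: "(\<Sum>j\<in>J. A j) *v x = (\<Sum>j\<in>J. (A j :: real ^ 'n ^ 'm) *v x)"
  by (induction J rule: infinite_finite_induct) (auto simp: matrix_vector_mult_add_rdistrib)

lemma matrix_vector_mult_minus_left: "(- A) *v x = - ((A :: real ^ 'n ^ 'm) *v x)"
  by (simp add: matrix_vector_mult_def vec_eq_iff sum_negf)

text \<open>The dimension-free growth estimate.  Applied to \<open>x\<close>, the field splits into
  \<open>- (b L + P) X\<^sub>i x\<close>, \<open>- X\<^sub>i (b L + Q) x\<close>, \<open>\<delta> (L x)\<^sub>i L e\<^sub>i\<close> and \<open>(X\<^sub>i x)\<^sub>i X\<^sub>i e\<^sub>i\<close> (the vectors \<open>Z1\<close> to \<open>Z4\<close> below).  The first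
  two give \<open>2 (b l + r) r\<close>, because \<open>P\<close> and \<open>Q\<close> both have norm at most \<open>r\<close>.  In the last two a scalar
  component of \<open>L x\<close> or of \<open>X\<^sub>i x\<close> multiplies a vector of norm at most \<open>l\<close> or \<open>r\<close>, so the sum of squares
  over \<open>i\<close> is controlled without loss.\<close>

lemma stack_bound_riccati_field:
  fixes L :: "real ^ 'n ^ 'n" and X :: "real ^ 'n ^ 'n ^ 'n"
  assumes sym: "symmetric_family X" and X: "stack_bound X r"
    and L: "\<And>x. norm (L *v x) \<le> l * norm x" and nonneg: "l \<ge> 0" "b \<ge> 0" "\<delta> \<ge> 0" "r \<ge> 0"
  shows "stack_bound (riccati_field L b \<delta> X) (2 * b * l * r + 3 * r\<^sup>2 + \<delta> * l\<^sup>2)"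
  unfolding stack_bound_def
proof
  fix x :: "real ^ 'n"
  have X': "norm (stack_apply X y) \<le> r * norm y" for y
    using X by (simp add: stack_bound_def)
  define P :: "real ^ 'n \<Rightarrow> real ^ 'n" where "P y = (\<Sum>j\<in>UNIV. y $ j *\<^sub>R (X $ j *v axis j 1))" for y
  define Q :: "real ^ 'n \<Rightarrow> real ^ 'n" where "Q y = (\<chi> j. (X $ j *v y) $ j)" for y
  \<comment> \<open>\<open>Q = \<Sum>\<^sub>j e\<^sub>j e\<^sub>j\<^sup>T X\<^sub>j\<close> picks one component from each block of the stacked vector.\<close>
  have Q: "norm (Q y) \<le> r * norm y" for y
  proof -
    have "norm (Q y) \<le> 1 * norm (stack_apply X y)"
      by (rule norm_le_by_components) (simp_all add: Q_def stack_apply_def component_le_norm_cart)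
    then show ?thesis using X'[of y] by simp
  qed
  \<comment> \<open>For a symmetric family \<open>P\<close> is the adjoint of \<open>Q\<close>, hence has the same norm.\<close>
  have P: "norm (P y) \<le> r * norm y" for y
  proof -
    have sym': "(X $ j *v axis j 1) \<bullet> z = Q z $ j" for j z
    proof -
      have "(X $ j *v axis j 1) \<bullet> z = axis j 1 \<bullet> (transpose (X $ j) *v z)"
        by (metis dot_lmul_matrix inner_commute transpose_matrix_vector transpose_transpose)
      also have "transpose (X $ j) = X $ j" using sym by (simp add: symmetric_family_def)
      finally show ?thesis by (simp add: Q_def inner_axis')
    qed
    have "norm (P y) * norm (P y) = P y \<bullet> P y"
      by (simp add: power2_norm_eq_inner[symmetric] power2_eq_square)
    also have "\<dots> = y \<bullet> Q (P y)"
      by (simp add: P_def[of y] inner_sum_left sym' inner_vec_def[of y])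
    also have "\<dots> \<le> norm y * (r * norm (P y))"
      using norm_cauchy_schwarz[of y "Q (P y)"] mult_left_mono[OF Q[of "P y"], of "norm y"] by simp
    finally have "norm (P y) * norm (P y) \<le> (r * norm y) * norm (P y)" by (simp add: mult_ac)
    then show ?thesis
      using nonneg by (cases "P y = 0") simp_all
  qed
  define A where "A y = b *\<^sub>R (L *v y) + P y" for y
  define B where "B y = b *\<^sub>R (L *v y) + Q y" for y
  have A_bound: "norm (A y) \<le> (b * l + r) * norm y" for y
  proof -
    have "norm (A y) \<le> b * norm (L *v y) + norm (P y)"
      unfolding A_def using nonneg by (metis norm_triangle_ineq norm_scaleR abs_of_nonneg)
    also have "\<dots> \<le> b * (l * norm y) + r * norm y"
      using nonneg L P by (intro add_mono mult_left_mono)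
    finally show ?thesis by (simp add: algebra_simps)
  qed
  have B_bound: "norm (B y) \<le> (b * l + r) * norm y" for y
  proof -
    have "norm (B y) \<le> b * norm (L *v y) + norm (Q y)"
      unfolding B_def using nonneg by (metis norm_triangle_ineq norm_scaleR abs_of_nonneg)
    also have "\<dots> \<le> b * (l * norm y) + r * norm y"
      using nonneg L Q by (intro add_mono mult_left_mono)
    finally show ?thesis by (simp add: algebra_simps)
  qed
  define Z1 Z2 Z3 Z4 :: "real ^ 'n ^ 'n"
    where "Z1 = (\<chi> i. A (X $ i *v x))" and "Z2 = stack_apply X (B x)"
      and "Z3 = (\<chi> i. (L *v x) $ i *\<^sub>R (L *v axis i 1))"
      and "Z4 = (\<chi> i. (X $ i *v x) $ i *\<^sub>R (X $ i *v axis i 1))"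
  have left: "(\<Sum>j\<in>UNIV. (- (b *\<^sub>R L) - X $ j) ** unit_outer j) *v y = - A y" for y
  proof -
    have "(\<Sum>j\<in>UNIV. (- (b *\<^sub>R L) - X $ j) ** unit_outer j) *v y
        = (\<Sum>j\<in>UNIV. (- (b *\<^sub>R L) - X $ j) *v (y $ j *\<^sub>R axis j 1))"
      by (simp add: sum_matrix_vector_mult matrix_vector_mul_assoc[symmetric] unit_outer_mult_vec)
    also have "\<dots> = (- (b *\<^sub>R L)) *v (\<Sum>j\<in>UNIV. y $ j *\<^sub>R axis j 1) - P y"
      by (simp only: matrix_vector_mult_diff_rdistrib sum_subtractf matrix_vector_mult_sum P_def
          matrix_vector_mult_scaleR scaleR_right_diff_distrib)
    also have "\<dots> = - A y"
      by (simp add: sum_axis A_def matrix_vector_mult_minus_left scaleR_matrix_vector_assoc[symmetric])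
    finally show ?thesis .
  qed
  have right: "(\<Sum>j\<in>UNIV. unit_outer j ** (- (b *\<^sub>R L) - X $ j)) *v y = - B y" for y
  proof -
    have "(\<Sum>j\<in>UNIV. unit_outer j ** (- (b *\<^sub>R L) - X $ j)) *v y
        = (\<Sum>j\<in>UNIV. (- (B y)) $ j *\<^sub>R axis j 1)"
      by (simp add: sum_matrix_vector_mult matrix_vector_mul_assoc[symmetric] unit_outer_mult_vec
          B_def Q_def matrix_vector_mult_diff_rdistrib matrix_vector_mult_minus_left
          scaleR_matrix_vector_assoc[symmetric])
    then show ?thesis by (simp only: sum_axis)
  qed
  have assoc_left: "(\<Sum>j\<in>UNIV. M j ** unit_outer j ** Y) = (\<Sum>j\<in>UNIV. M j ** unit_outer j) ** Y"
    for M :: "'n \<Rightarrow> real ^ 'n ^ 'n" and Y :: "real ^ 'n ^ 'n"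
    by (simp add: matrix_eq sum_matrix_vector_mult matrix_vector_mul_assoc[symmetric])
  have assoc_right: "(\<Sum>j\<in>UNIV. Y ** unit_outer j ** M j) = Y ** (\<Sum>j\<in>UNIV. unit_outer j ** M j)"
    for M :: "'n \<Rightarrow> real ^ 'n ^ 'n" and Y :: "real ^ 'n ^ 'n"
    by (simp add: matrix_eq sum_matrix_vector_mult matrix_vector_mul_assoc[symmetric] matrix_vector_mult_sum)
  have "stack_apply (riccati_field L b \<delta> X) x $ i = (- Z1 - Z2 + \<delta> *\<^sub>R Z3 + Z4) $ i" for i
    unfolding stack_apply_def riccati_field_def assoc_left assoc_right
    by (simp add: Z1_def Z2_def Z3_def Z4_def stack_apply_def matrix_vector_mult_add_rdistrib
        matrix_vector_mul_assoc[symmetric] left right unit_outer_mult_vec matrix_vector_mult_scaleR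
        scaleR_matrix_vector_assoc[symmetric] linear_neg[OF matrix_vector_mul_linear])
  then have "stack_apply (riccati_field L b \<delta> X) x = - Z1 - Z2 + \<delta> *\<^sub>R Z3 + Z4"
    by (subst vec_eq_iff) blast
  also have "norm \<dots> \<le> norm Z1 + norm Z2 + \<delta> * norm Z3 + norm Z4"
    using norm_triangle_ineq[of "- Z1 - Z2 + \<delta> *\<^sub>R Z3" Z4]
      norm_triangle_ineq[of "- Z1 - Z2" "\<delta> *\<^sub>R Z3"] norm_triangle_ineq4[of "- Z1" Z2] nonneg
    by simp
  also have "\<dots> \<le> (b * l + r) * (r * norm x) + r * ((b * l + r) * norm x)
      + \<delta> * (l * (l * norm x)) + r * (r * norm x)"
  proof (intro add_mono mult_left_mono)
    have "norm Z1 \<le> (b * l + r) * norm (stack_apply X x)"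
      by (rule norm_le_by_components) (use nonneg A_bound in \<open>simp_all add: Z1_def stack_apply_def\<close>)
    then show "norm Z1 \<le> (b * l + r) * (r * norm x)"
      using X'[of x] nonneg by (meson mult_left_mono order_trans add_nonneg_nonneg mult_nonneg_nonneg)
    show "norm Z2 \<le> r * ((b * l + r) * norm x)"
      unfolding Z2_def using X'[of "B x"] B_bound[of x] nonneg by (meson mult_left_mono order_trans)
    have "norm Z3 \<le> l * norm (L *v x)"
    proof (rule norm_le_by_components)
      fix i
      have "norm (L *v axis i 1) \<le> l" using L[of "axis i 1"] by simp
      then show "norm (Z3 $ i) \<le> l * norm ((L *v x) $ i)"
        using mult_right_mono[of "norm (L *v axis i 1)" l "\<bar>(L *v x) $ i\<bar>"]
        by (simp add: Z3_def mult.commute)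
    qed (use nonneg in auto)
    then show "norm Z3 \<le> l * (l * norm x)"
      using L[of x] nonneg by (meson mult_left_mono order_trans)
    have "norm Z4 \<le> r * norm (stack_apply X x)"
    proof (rule norm_le_by_components)
      fix i
      have "norm (X $ i *v axis i 1) \<le> norm (stack_apply X (axis i 1))"
        using Finite_Cartesian_Product.norm_nth_le[of "stack_apply X (axis i 1)" i] by (simp add: stack_apply_def)
      also have "\<dots> \<le> r" using X'[of "axis i 1"] by simp
      finally have "norm (X $ i *v axis i 1) \<le> r" .
      then have "\<bar>(X $ i *v x) $ i\<bar> * norm (X $ i *v axis i 1) \<le> norm (X $ i *v x) * r"
        by (intro mult_mono component_le_norm_cart) auto
      then show "norm (Z4 $ i) \<le> r * norm (stack_apply X x $ i)"
        by (simp add: Z4_def stack_apply_def mult.commute)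
    qed (use nonneg in auto)
    then show "norm Z4 \<le> r * (r * norm x)"
      using X'[of x] nonneg by (meson mult_left_mono order_trans)
  qed (use nonneg in auto)
  also have "\<dots> = (2 * b * l * r + 3 * r\<^sup>2 + \<delta> * l\<^sup>2) * norm x"
    by (simp add: algebra_simps power2_eq_square)
  finally show "norm (stack_apply (riccati_field L b \<delta> X) x)
      \<le> (2 * b * l * r + 3 * r\<^sup>2 + \<delta> * l\<^sup>2) * norm x" .
qed

text \<open>Since \<open>L e\<^sub>i e\<^sub>i\<^sup>T L x = (L x)\<^sub>i L e\<^sub>i\<close>, the squares of the coefficients \<open>(L x)\<^sub>i\<close> sum to \<open>\<parallel>L x\<parallel>\<^sup>2\<close>
  and no factor depending on the number of matrices appears.\<close>

lemma stack_bound_rank_one_family: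
  fixes L :: "real ^ 'n ^ 'n"
  assumes L: "\<And>x. norm (L *v x) \<le> l * norm x" and nonneg: "l \<ge> 0" "c \<ge> 0"
  shows "stack_bound (\<chi> i. c *\<^sub>R (L ** unit_outer i ** L)) (c * l\<^sup>2)"
  unfolding stack_bound_def
proof
  fix x :: "real ^ 'n"
  have "norm (stack_apply (\<chi> i. c *\<^sub>R (L ** unit_outer i ** L)) x) \<le> (c * l) * norm (L *v x)"
  proof (rule norm_le_by_components)
    fix i
    have "norm (L *v axis i 1) \<le> l" using L[of "axis i 1"] by simp
    then have "c * (\<bar>(L *v x) $ i\<bar> * norm (L *v axis i 1)) \<le> c * (\<bar>(L *v x) $ i\<bar> * l)"
      using nonneg by (intro mult_left_mono) auto
    then show "norm (stack_apply (\<chi> i. c *\<^sub>R (L ** unit_outer i ** L)) x $ i) \<le> c * l * norm ((L *v x) $ i)"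
      using nonneg by (simp add: stack_apply_def matrix_vector_mul_assoc[symmetric] unit_outer_mult_vec
          matrix_vector_mult_scaleR scaleR_matrix_vector_assoc[symmetric] mult_ac abs_mult)
  qed (use nonneg in auto)
  also have "\<dots> \<le> (c * l) * (l * norm x)"
    using L nonneg by (intro mult_left_mono) auto
  finally show "norm (stack_apply (\<chi> i. c *\<^sub>R (L ** unit_outer i ** L)) x) \<le> c * l\<^sup>2 * norm x"
    by (simp add: power2_eq_square mult_ac)
qed

section \<open>Lipschitz continuity on bounded sets\<close>

text \<open>Hiding the constant makes Lipschitz continuity of a polynomial map follow from closure rules
  applied along its syntax.\<close>

definition lipschitzian_on :: "'a::metric_space set \<Rightarrow> ('a \<Rightarrow> 'b::metric_space) \<Rightarrow> bool" where
  "lipschitzian_on S f \<longleftrightarrow> (\<exists>C. C-lipschitz_on S f)"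

lemma lipschitzian_on_const: "lipschitzian_on S (\<lambda>x. c)"
  unfolding lipschitzian_on_def using lipschitz_on_constant by blast

lemma lipschitzian_on_nth: "lipschitzian_on S (\<lambda>X :: 'b::real_normed_vector ^ 'n. X $ i)"
  unfolding lipschitzian_on_def
  by (intro exI[of _ 1] lipschitz_onI)
    (metis Finite_Cartesian_Product.norm_nth_le dist_norm mult_1 vector_minus_component, simp)

lemma lipschitzian_on_add:
  fixes f g :: "'a::metric_space \<Rightarrow> 'b::real_normed_vector"
  shows "lipschitzian_on S f \<Longrightarrow> lipschitzian_on S g \<Longrightarrow> lipschitzian_on S (\<lambda>x. f x + g x)"
  unfolding lipschitzian_on_def using lipschitz_on_add by blast

lemma lipschitzian_on_diff:
  fixes f g :: "'a::metric_space \<Rightarrow> 'b::real_normed_vector"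
  shows "lipschitzian_on S f \<Longrightarrow> lipschitzian_on S g \<Longrightarrow> lipschitzian_on S (\<lambda>x. f x - g x)"
  unfolding lipschitzian_on_def using lipschitz_on_diff by blast

lemma lipschitzian_on_sum:
  fixes f :: "'i \<Rightarrow> 'a::metric_space \<Rightarrow> 'b::real_normed_vector"
  shows "(\<And>i. i \<in> I \<Longrightarrow> lipschitzian_on S (f i)) \<Longrightarrow> lipschitzian_on S (\<lambda>x. \<Sum>i\<in>I. f i x)"
  by (induction I rule: infinite_finite_induct)
    (auto intro: lipschitzian_on_const lipschitzian_on_add)

lemma lipschitzian_on_vec_lambda:
  fixes f :: "'n::finite \<Rightarrow> 'a::metric_space \<Rightarrow> 'b::real_normed_vector"
  assumes "\<And>i. lipschitzian_on S (f i)"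
  shows "lipschitzian_on S (\<lambda>x. \<chi> i. f i x)"
proof -
  obtain C where C: "\<And>i. (C i)-lipschitz_on S (f i)"
    using assms unfolding lipschitzian_on_def by metis
  have "(\<Sum>i\<in>UNIV. C i)-lipschitz_on S (\<lambda>x. \<chi> i. f i x)"
  proof (rule lipschitz_onI)
    fix x y assume xy: "x \<in> S" "y \<in> S"
    have "dist (\<chi> i. f i x) (\<chi> i. f i y) \<le> (\<Sum>i\<in>UNIV. norm (((\<chi> i. f i x) - (\<chi> i. f i y)) $ i))"
      unfolding dist_norm by (rule norm_vec_le_sum)
    also have "\<dots> \<le> (\<Sum>i\<in>UNIV. C i * dist x y)"
      using lipschitz_onD[OF C xy] by (intro sum_mono) (simp add: dist_norm)
    finally show "dist (\<chi> i. f i x) (\<chi> i. f i y) \<le> (\<Sum>i\<in>UNIV. C i) * dist x y"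
      by (simp add: sum_distrib_right)
  qed (intro sum_nonneg lipschitz_on_nonneg[OF C])
  then show ?thesis unfolding lipschitzian_on_def by blast
qed

text \<open>Boundedness of \<open>S\<close> is what bounds both factors, so that the product rule
  \<open>m u v - m u' v' = m (u - u') v + m u' (v - v')\<close> yields a finite constant.\<close>

lemma lipschitzian_on_bilinear:
  fixes f :: "'a::heine_borel \<Rightarrow> 'b::{real_normed_vector, heine_borel}"
    and g :: "'a \<Rightarrow> 'c::{real_normed_vector, heine_borel}"
    and m :: "'b \<Rightarrow> 'c \<Rightarrow> 'd::real_normed_vector"
  assumes m: "bounded_bilinear m" and S: "bounded S"
    and f: "lipschitzian_on S f" and g: "lipschitzian_on S g"
  shows "lipschitzian_on S (\<lambda>x. m (f x) (g x))"
proof -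
  obtain Cf Cg where Cf: "Cf-lipschitz_on S f" and Cg: "Cg-lipschitz_on S g"
    using f g unfolding lipschitzian_on_def by blast
  have "bounded (f ` S)" "bounded (g ` S)"
    using Cf Cg S by (auto intro: bounded_uniformly_continuous_image lipschitz_on_uniformly_continuous)
  then obtain Bf Bg where Bf: "\<And>x. x \<in> S \<Longrightarrow> norm (f x) \<le> Bf" "Bf > 0"
    and Bg: "\<And>x. x \<in> S \<Longrightarrow> norm (g x) \<le> Bg" "Bg > 0"
    unfolding bounded_pos by (metis imageI)
  obtain M where M: "M > 0" "\<And>u v. norm (m u v) \<le> norm u * norm v * M"
    using bounded_bilinear.pos_bounded[OF m] by blast
  have C0: "Cf \<ge> 0" "Cg \<ge> 0" using Cf Cg lipschitz_on_nonneg by blast+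
  have "((Cf * Bg + Bf * Cg) * M)-lipschitz_on S (\<lambda>x. m (f x) (g x))"
  proof (rule lipschitz_onI)
    fix x y assume xy: "x \<in> S" "y \<in> S"
    have "m (f x) (g x) - m (f y) (g y) = m (f x - f y) (g x) + m (f y) (g x - g y)"
      by (simp add: bounded_bilinear.diff_left[OF m] bounded_bilinear.diff_right[OF m])
    then have "norm (m (f x) (g x) - m (f y) (g y))
        \<le> norm (f x - f y) * norm (g x) * M + norm (f y) * norm (g x - g y) * M"
      using M(2) by (metis add_mono norm_triangle_le)
    also have "\<dots> \<le> (Cf * dist x y) * Bg * M + Bf * (Cg * dist x y) * M"
      using xy C0 Bf Bg M(1) lipschitz_onD[OF Cf xy] lipschitz_onD[OF Cg xy]
      by (intro add_mono mult_mono) (auto simp: dist_norm intro!: mult_nonneg_nonneg less_imp_le)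
    finally show "dist (m (f x) (g x)) (m (f y) (g y)) \<le> (Cf * Bg + Bf * Cg) * M * dist x y"
      by (simp add: dist_norm algebra_simps)
  qed (use C0 Bf Bg M in auto)
  then show ?thesis unfolding lipschitzian_on_def by blast
qed

lemma bounded_bilinear_matrix_mult:
  "bounded_bilinear ((**) :: real ^ 'm ^ 'n \<Rightarrow> real ^ 'p ^ 'm \<Rightarrow> real ^ 'p ^ 'n)"
  unfolding bilinear_conv_bounded_bilinear[symmetric] bilinear_def
  by (auto intro!: linearI simp: vec_eq_iff matrix_matrix_mult_def algebra_simps sum.distrib sum_distrib_left)

lemma lipschitzian_on_riccati_field:
  assumes "bounded S"
  shows "lipschitzian_on S (riccati_field L b \<delta>)"
  unfolding riccati_field_def
  by (intro lipschitzian_on_vec_lambda lipschitzian_on_add lipschitzian_on_diff lipschitzian_on_sum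
      lipschitzian_on_bilinear[OF bounded_bilinear_matrix_mult assms] lipschitzian_on_const lipschitzian_on_nth)

section \<open>Time reversal\<close>

lemma has_vector_derivative_reverse:
  fixes g :: "real \<Rightarrow> 'a::real_normed_vector"
  assumes "(g has_vector_derivative D) (at (T - s) within {0..T})"
  shows "((\<lambda>s. g (T - s)) has_vector_derivative - D) (at s within {0..T})"
proof -
  have "((\<lambda>s. T - s) has_vector_derivative - 1) (at s within {0..T})"
    by (auto intro!: derivative_eq_intros)
  moreover have "(\<lambda>s. T - s) ` {0..T} = {0..T}" by simp
  ultimately show ?thesis
    using vector_diff_chain_within[of "\<lambda>s. T - s" "- 1" s "{0..T}" g D] assms by (simp add: o_def)
qed

lemma has_vector_derivative_vec_iff:
  fixes g :: "real \<Rightarrow> 'a::real_normed_vector ^ 'n"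
  shows "(g has_vector_derivative D) (at s within S) \<longleftrightarrow>
    (\<forall>i. ((\<lambda>s. g s $ i) has_vector_derivative D $ i) (at s within S))"
proof
  assume "(g has_vector_derivative D) (at s within S)"
  then show "\<forall>i. ((\<lambda>s. g s $ i) has_vector_derivative D $ i) (at s within S)"
    using bounded_linear.has_vector_derivative[OF bounded_linear_vec_nth] by blast
next
  assume "\<forall>i. ((\<lambda>s. g s $ i) has_vector_derivative D $ i) (at s within S)"
  then show "(g has_vector_derivative D) (at s within S)"
    by (auto simp: has_vector_derivative_def has_derivative_within bounded_linear_scaleR_left
        intro!: vec_tendstoI)
qed

definition reversed_family ::
    "real \<Rightarrow> ('n::finite \<Rightarrow> real \<Rightarrow> real ^ 'n ^ 'n) \<Rightarrow> real \<Rightarrow> real ^ 'n ^ 'n ^ 'n" where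
  "reversed_family T F s = (\<chi> i. F i (T - s))"

text \<open>In reversed time the terminal value problem becomes an initial value problem for
  \<open>riccati_field\<close>.  As an equivalence it serves existence in one direction and uniqueness in the other.\<close>

lemma riccati_solution_iff_reversed:
  fixes L :: "real ^ 'n ^ 'n"
  assumes "T > 0"
  shows "riccati_solution L a q \<epsilon> c T F \<longleftrightarrow>
    (\<forall>s\<in>{0..T}. symmetric_family (reversed_family T F s)) \<and>
    (\<forall>s\<in>{0..T}. (reversed_family T F has_vector_derivative riccati_field L (a + q) (\<epsilon> - q\<^sup>2) (reversed_family T F s)) (at s within {0..T})) \<and>
    reversed_family T F 0 = (\<chi> i. c *\<^sub>R (L ** unit_outer i ** L))"
proof -
  define R where "R i t = riccati_field L (a + q) (\<epsilon> - q\<^sup>2) (reversed_family T F (T - t)) $ i" for i t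
  have flip: "(\<forall>s\<in>{0..T}. Q s) \<longleftrightarrow> (\<forall>t\<in>{0..T}. Q (T - t))" for Q :: "real \<Rightarrow> bool"
  proof safe
    fix s assume "\<forall>t\<in>{0..T}. Q (T - t)" "s \<in> {0..T}"
    then show "Q s" by (auto dest!: bspec[of _ _ "T - s"])
  qed auto
  have sym: "(\<forall>s\<in>{0..T}. symmetric_family (reversed_family T F s)) \<longleftrightarrow> (\<forall>i. \<forall>t\<in>{0..T}. transpose (F i t) = F i t)"
    by (subst flip) (auto simp: symmetric_family_def reversed_family_def)
  have deriv: "(\<exists>D. (F i has_vector_derivative D) (at t within {0..T}) \<and>
        D + (\<Sum>j\<in>UNIV. (- ((a + q) *\<^sub>R L) - F j t) ** unit_outer j ** F i t)
          + (\<Sum>j\<in>UNIV. F i t ** unit_outer j ** (- ((a + q) *\<^sub>R L) - F j t))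
          + (\<epsilon> - q\<^sup>2) *\<^sub>R (L ** unit_outer i ** L)
          + F i t ** unit_outer i ** F i t = 0) \<longleftrightarrow>
      ((\<lambda>s. reversed_family T F s $ i) has_vector_derivative R i t) (at (T - t) within {0..T})" (is "?l = ?r") for i t
  proof -
    have "?l \<longleftrightarrow> (F i has_vector_derivative - R i t) (at t within {0..T})"
      by (auto simp: R_def riccati_field_def reversed_family_def add.assoc add_eq_0_iff2 eq_neg_iff_add_eq_0)
    also have "\<dots> \<longleftrightarrow> ?r"
      using has_vector_derivative_reverse[of "F i" "- R i t" T "T - t"]
        has_vector_derivative_reverse[of "\<lambda>s. reversed_family T F s $ i" "R i t" T t]
      by (auto simp: reversed_family_def)
    finally show ?thesis .
  qed
  have final: "reversed_family T F 0 = (\<chi> i. c *\<^sub>R (L ** unit_outer i ** L)) \<longleftrightarrow> (\<forall>i. F i T = c *\<^sub>R (L ** unit_outer i ** L))"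
    by (simp add: reversed_family_def vec_eq_iff[where 'b = 'n and 'a = "real ^ 'n ^ 'n"])
  have "(\<forall>s\<in>{0..T}. (reversed_family T F has_vector_derivative riccati_field L (a + q) (\<epsilon> - q\<^sup>2) (reversed_family T F s)) (at s within {0..T}))
    \<longleftrightarrow> (\<forall>i. \<forall>t\<in>{0..T}. ((\<lambda>s. reversed_family T F s $ i) has_vector_derivative R i t) (at (T - t) within {0..T}))"
    by (subst flip) (auto simp: has_vector_derivative_vec_iff R_def)
  then show ?thesis
    unfolding riccati_solution_def deriv sym final by blast
qed

text \<open>Any two solutions are continuous on \<open>[0, T]\<close>, so they trace out compact sets, on whose union
  the field is Lipschitz.\<close>

lemma riccati_solution_unique:
  assumes T: "T > 0" and F: "riccati_solution L a q \<epsilon> c T F" and F': "riccati_solution L a q \<epsilon> c T F'"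
    and t: "t \<in> {0..T}"
  shows "F' i t = F i t"
proof -
  define g g' where "g = reversed_family T F" and "g' = reversed_family T F'"
  note sol = F[unfolded riccati_solution_iff_reversed[OF T], folded g_def]
    F'[unfolded riccati_solution_iff_reversed[OF T], folded g'_def]
  have "continuous_on {0..T} g" "continuous_on {0..T} g'"
    using sol by (metis continuous_on_eq_continuous_within has_vector_derivative_continuous)+
  then have "bounded (g ` {0..T} \<union> g' ` {0..T})"
    by (auto intro!: compact_imp_bounded compact_continuous_image)
  then obtain \<Lambda> where "\<Lambda>-lipschitz_on (g ` {0..T} \<union> g' ` {0..T}) (riccati_field L (a + q) (\<epsilon> - q\<^sup>2))"
    using lipschitzian_on_riccati_field unfolding lipschitzian_on_def by blast
  then have "g' (T - t) = g (T - t)"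
    by (rule ode_solution_unique[where T = T]) (use sol t in auto)
  then have "g' (T - t) $ i = g (T - t) $ i" by simp
  then show ?thesis by (simp add: g_def g'_def reversed_family_def)
qed

section \<open>Existence under the smallness condition\<close>

text \<open>This is where the numerical constants are used, with a margin:
  \<open>T (2 b l + 3 R) \<le> ln 2 + 3 \<cdot> exp 1 / 100 \<le> 25 / 36 + 9 / 100 < 1\<close> for \<open>R = \<kappa> exp (s / T)\<close>.\<close>

lemma majorant_inequality:
  fixes T b l \<kappa> s :: real
  assumes "T > 0" "\<kappa> \<ge> 0" and s: "s \<in> {0..T}"
    and small: "100 * T * \<kappa> \<le> 1" "2 * b * T * l \<le> ln 2"
  shows "2 * b * l * (\<kappa> * exp (s / T)) + 3 * (\<kappa> * exp (s / T))\<^sup>2 \<le> \<kappa> / T * exp (s / T)"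
proof -
  define R where "R = \<kappa> * exp (s / T)"
  have "exp (s / T) \<le> exp 1" using assms by simp
  also have "\<dots> \<le> 3" by (rule exp_le)
  finally have "T * \<kappa> * exp (s / T) \<le> T * \<kappa> * 3" using assms by (intro mult_left_mono) auto
  then have "3 * (T * R) \<le> 9 / 100" using small(1) by (simp add: R_def mult_ac)
  moreover have "2 * b * T * l \<le> 25 / 36" using small(2) ln2_le_25_over_36 by linarith
  ultimately have "2 * b * T * l + 3 * (T * R) \<le> 1" by linarith
  moreover have "R \<ge> 0" using assms by (simp add: R_def)
  ultimately have "R * (2 * b * T * l + 3 * (T * R)) \<le> R * 1" by (intro mult_left_mono)
  then have "(2 * b * l * R + 3 * R\<^sup>2) * T \<le> R"
    by (simp add: algebra_simps power2_eq_square)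
  then show ?thesis using \<open>T > 0\<close> by (simp add: R_def pos_le_divide_eq)
qed

lemma stack_bound_mono: "stack_bound X r \<Longrightarrow> r \<le> r' \<Longrightarrow> stack_bound X r'"
  unfolding stack_bound_def by (meson mult_right_mono norm_ge_zero order_trans)

text \<open>Picard iteration in the sets of symmetric families \<open>X\<close> with \<open>\<nu>(X) \<le> R(s) = \<kappa> exp (s / T)\<close>.
  The constant source \<open>\<delta> l\<^sup>2\<close> is not put into the differential inequality for \<open>R\<close>: integrated, it contributes
  at most \<open>T \<delta> l\<^sup>2\<close>, which \<open>R(0) = \<kappa> = c l\<^sup>2 + T \<delta> l\<^sup>2\<close> has in reserve beyond the initial bound \<open>c l\<^sup>2\<close>.\<close>

lemma riccati_solution_exists:
  fixes L :: "real ^ 'n ^ 'n"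
  assumes L: "transpose L = L" and T: "T > 0" and nonneg: "a + q \<ge> 0" "q\<^sup>2 \<le> \<epsilon>" "c \<ge> 0"
    and small: "100 * T * (c + T * (\<epsilon> - q\<^sup>2)) * (matrix_norm2 L)\<^sup>2 \<le> 1"
      "2 * (a + q) * T * matrix_norm2 L \<le> ln 2"
  shows "\<exists>F. riccati_solution L a q \<epsilon> c T F"
proof -
  define b \<delta> l \<kappa> where "b = a + q" and "\<delta> = \<epsilon> - q\<^sup>2" and "l = matrix_norm2 L"
    and "\<kappa> = (c + T * \<delta>) * l\<^sup>2"
  define R where "R s = \<kappa> * exp (s / T)" for s
  define x0 :: "real ^ 'n ^ 'n ^ 'n" where "x0 = (\<chi> i. c *\<^sub>R (L ** unit_outer i ** L))"
  define K where "K s = {X :: real ^ 'n ^ 'n ^ 'n. symmetric_family X} \<inter> {X. stack_bound X (R s)}" for s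
  define f where "f = riccati_field L b \<delta>"
  have bl: "bounded_linear (\<lambda>x. L *v x)" by (rule matrix_vector_mul_bounded_linear)
  have Ll: "norm (L *v x) \<le> l * norm x" for x
    unfolding l_def matrix_norm2_def by (rule onorm[OF bl])
  have pos: "l \<ge> 0" "b \<ge> 0" "\<delta> \<ge> 0" "\<kappa> \<ge> 0"
    using onorm_pos_le[OF bl] nonneg T by (simp_all add: l_def matrix_norm2_def b_def \<delta>_def \<kappa>_def)
  have R_pos: "R s \<ge> 0" for s using pos by (simp add: R_def)
  have \<kappa>_R: "\<kappa> \<le> R s" if "s \<in> {0..T}" for s
    using that T pos mult_left_mono[of 1 "exp (s / T)" \<kappa>] by (simp add: R_def)
  have x0_sym: "symmetric_family x0"
    by (simp add: symmetric_family_def x0_def transpose_scalar matrix_transpose_mul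
        transpose_unit_outer L matrix_mul_assoc)
  have x0_bound: "stack_bound x0 (c * l\<^sup>2)"
    unfolding x0_def using Ll pos nonneg by (intro stack_bound_rank_one_family) auto
  have "bounded (\<Union>s\<in>{0..T}. K s)"
    unfolding bounded_iff
  proof (intro exI ballI)
    fix X assume "X \<in> (\<Union>s\<in>{0..T}. K s)"
    then obtain s where s: "s \<in> {0..T}" and X: "stack_bound X (R s)" by (auto simp: K_def)
    have "R s \<le> R T"
      unfolding R_def using s T pos by (intro mult_left_mono) (auto simp: divide_right_mono)
    then show "norm X \<le> real CARD('n) * real CARD('n) * real CARD('n) * R T"
      by (intro stack_bound_imp_norm_le stack_bound_mono[OF X])
  qed
  then obtain \<Lambda> where lip: "\<Lambda>-lipschitz_on (\<Union>s\<in>{0..T}. K s) f"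
    using lipschitzian_on_riccati_field unfolding lipschitzian_on_def f_def by blast
  obtain G where G: "G 0 = x0" "\<And>s. s \<in> {0..T} \<Longrightarrow> G s \<in> K s"
    "\<And>s. s \<in> {0..T} \<Longrightarrow> (G has_vector_derivative f (G s)) (at s within {0..T})"
  proof (rule picard_in_moving_closed_set[OF lip])
    show "closed (K s)" for s
      unfolding K_def by (intro closed_Int closed_symmetric_family closed_stack_bound)
    show "x0 \<in> K s" if "s \<in> {0..T}" for s
    proof -
      have "c * l\<^sup>2 \<le> \<kappa>" using T pos by (simp add: \<kappa>_def algebra_simps)
      then show ?thesis
        unfolding K_def using x0_sym stack_bound_mono[OF x0_bound] \<kappa>_R[OF that] by auto
    qed
  next
    fix g s
    assume g: "continuous_on {0..T} g" "\<And>r. r \<in> {0..T} \<Longrightarrow> g r \<in> K r" and s: "s \<in> {0..T}"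
    define I where "I = integral {0..s} (\<lambda>r. f (g r))"
    have f_sym: "symmetric_family (f (g r))" if "r \<in> {0..T}" for r
      unfolding f_def using g(2)[OF that] by (auto simp: K_def intro: symmetric_family_riccati_field[OF L])
    have f_bound: "stack_bound (f (g r)) (\<kappa> / T * exp (r / T) + \<delta> * l\<^sup>2)" if r: "r \<in> {0..T}" for r
    proof -
      have "stack_bound (f (g r)) (2 * b * l * R r + 3 * (R r)\<^sup>2 + \<delta> * l\<^sup>2)"
        unfolding f_def using g(2)[OF r] Ll pos R_pos
        by (intro stack_bound_riccati_field) (auto simp: K_def)
      moreover have "2 * b * l * R r + 3 * (R r)\<^sup>2 \<le> \<kappa> / T * exp (r / T)"
        unfolding R_def using T pos r small
        by (intro majorant_inequality) (simp_all add: b_def l_def \<kappa>_def \<delta>_def mult_ac)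
      ultimately show ?thesis by (auto intro: stack_bound_mono)
    qed
    have fg_cont: "continuous_on {0..T} (\<lambda>r. f (g r))"
      using g by (intro continuous_on_compose2[OF lipschitz_on_continuous_on[OF lip]]) auto
    have fg_int: "(\<lambda>r. f (g r)) integrable_on {0..s}"
      using s by (intro integrable_continuous_real continuous_on_subset[OF fg_cont]) auto
    have "symmetric_family (x0 + I)"
      unfolding symmetric_family_def
    proof
      fix i
      \<comment> \<open>Symmetry is the vanishing of a bounded linear map, which commutes with the integral.\<close>
      define h where "h = (\<lambda>X :: real ^ 'n ^ 'n ^ 'n. transpose (X $ i) - X $ i)"
      have "bounded_linear h"
        unfolding h_def
        by (intro bounded_linear_sub bounded_linear_compose[OF bounded_linear_transpose] bounded_linear_vec_nth)
      then have "h I = integral {0..s} (\<lambda>r. h (f (g r)))"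
        unfolding I_def using integral_linear[OF fg_int, of h] by (simp add: o_def)
      also have "\<dots> = integral {0..s} (\<lambda>r. 0)"
        using f_sym s by (intro integral_cong) (auto simp: h_def symmetric_family_def)
      finally have "transpose (I $ i) = I $ i" by (simp add: h_def)
      then show "transpose ((x0 + I) $ i) = (x0 + I) $ i"
        using x0_sym by (simp add: symmetric_family_def transpose_add)
    qed
    moreover have "stack_bound (x0 + I) (R s)"
      unfolding stack_bound_def
    proof
      fix x
      define h where "h = (\<lambda>X :: real ^ 'n ^ 'n ^ 'n. stack_apply X x)"
      have h: "bounded_linear h"
        unfolding h_def by (intro linear_conv_bounded_linear[THEN iffD1] linear_stack_apply)
      have maj: "((\<lambda>r. (\<kappa> / T * exp (r / T) + \<delta> * l\<^sup>2) * norm x) has_integral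
          (R s + \<delta> * l\<^sup>2 * s) * norm x - (R 0 + \<delta> * l\<^sup>2 * 0) * norm x) {0..s}"
        unfolding R_def using s T
        by (intro fundamental_theorem_of_calculus)
          (auto intro!: derivative_eq_intros simp flip: has_real_derivative_iff_has_vector_derivative)
      have "norm (h I) = norm (integral {0..s} (\<lambda>r. h (f (g r))))"
        unfolding I_def using integral_linear[OF fg_int h] by (simp add: o_def)
      also have "\<dots> \<le> integral {0..s} (\<lambda>r. (\<kappa> / T * exp (r / T) + \<delta> * l\<^sup>2) * norm x)"
      proof (rule integral_norm_bound_integral)
        show "(\<lambda>r. h (f (g r))) integrable_on {0..s}"
          using integrable_linear[OF fg_int h] by (simp add: o_def)
        show "(\<lambda>r. (\<kappa> / T * exp (r / T) + \<delta> * l\<^sup>2) * norm x) integrable_on {0..s}"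
          using maj by blast
        show "norm (h (f (g r))) \<le> (\<kappa> / T * exp (r / T) + \<delta> * l\<^sup>2) * norm x" if "r \<in> {0..s}" for r
          using f_bound[of r] that s unfolding stack_bound_def h_def by simp
      qed
      also have "\<dots> = (R s + \<delta> * l\<^sup>2 * s - \<kappa>) * norm x"
        using integral_unique[OF maj] by (simp add: R_def algebra_simps)
      finally have hI: "norm (h I) \<le> (R s + \<delta> * l\<^sup>2 * s - \<kappa>) * norm x" .
      have "norm (h (x0 + I)) \<le> norm (h x0) + norm (h I)"
        using linear_add[OF bounded_linear.linear[OF h]] by (simp add: norm_triangle_ineq)
      also have "\<dots> \<le> c * l\<^sup>2 * norm x + (R s + \<delta> * l\<^sup>2 * s - \<kappa>) * norm x"
        using x0_bound hI by (intro add_mono) (auto simp: stack_bound_def h_def)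
      also have "\<dots> = (R s - \<delta> * l\<^sup>2 * (T - s)) * norm x"
        by (simp add: \<kappa>_def algebra_simps)
      also have "\<dots> \<le> R s * norm x"
        using s pos by (intro mult_right_mono) auto
      finally show "norm (stack_apply (x0 + I) x) \<le> R s * norm x" by (simp add: h_def)
    qed
    ultimately show "x0 + integral {0..s} (\<lambda>r. f (g r)) \<in> K s"
      by (simp add: K_def I_def)
  qed (use that in blast)
  have "riccati_solution L a q \<epsilon> c T (\<lambda>i t. G (T - t) $ i)"
    unfolding riccati_solution_iff_reversed[OF T]
    using G by (auto simp: reversed_family_def[abs_def] x0_def K_def f_def b_def \<delta>_def)
  then show ?thesis by blast
qed

section \<open>The normalized Laplacian\<close>

lemma transpose_normalized_laplacian:
  assumes "graph G"
  shows "transpose (normalized_laplacian G v) = normalized_laplacian G v"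
proof -
  interpret graph G by fact
  have "x \<rightarrow>\<^bsub>G\<^esub> y \<longleftrightarrow> y \<rightarrow>\<^bsub>G\<^esub> x" for x y
    using graph_symmetric by blast
  then show ?thesis
    by (auto simp: normalized_laplacian_def transpose_def vec_eq_iff mult.commute)
qed

theorem corollary3p11:
  fixes G :: "('a, 'b) pre_digraph"
    and v :: "'n::finite \<Rightarrow> 'a"
    and L :: "real ^ 'n ^ 'n"
    and T a q \<epsilon> c :: real
  assumes "graph G" and "Digraph_Component.connected G"
    and "bij_betw v UNIV (verts G)"
    and "L = normalized_laplacian G v"
    and "T > 0" and "a \<ge> 0" and "q \<ge> 0" and "\<epsilon> \<ge> 0" and "c > 0"
    and "q\<^sup>2 \<le> \<epsilon>"
    and "max (100 * T * (c + T * (\<epsilon> - q\<^sup>2)) * (matrix_norm2 L)\<^sup>2)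
             (2 / ln 2 * (a + q) * T * matrix_norm2 L) \<le> 1"
  shows "\<exists>F. riccati_solution L a q \<epsilon> c T F \<and>
           (\<forall>F'. riccati_solution L a q \<epsilon> c T F' \<longrightarrow> (\<forall>i. \<forall>t\<in>{0..T}. F' i t = F i t))"
proof -
  have "2 * (a + q) * T * matrix_norm2 L \<le> ln 2"
    using assms(11) by (simp add: field_simps)
  then obtain F where F: "riccati_solution L a q \<epsilon> c T F"
    using riccati_solution_exists[of L T a q \<epsilon> c] transpose_normalized_laplacian[OF assms(1)] assms
    by auto
  show ?thesis
    by (intro exI[of _ F] conjI F allI impI ballI riccati_solution_unique[OF assms(5) F])
qed

end
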